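(* Let $n,m\ge 1$ be integers, $\mathcal{X}$ a set of inputs, $\boldsymbol{I}:\mathcal{X}\to\mathbb{R}^n$ the (known) feature map, and let $W_S=(w_{ij})\in\mathbb{R}^{n\times m}$ and $\boldsymbol{b}_S=(b_{S,1},\dots,b_{S,m})\in\mathbb{R}^m$ be the weight matrix and bias vector of the last layer of the student network, whose output is $\mathcal{O}_{\theta,j}(\boldsymbol{x})=\max\{0,y_j(\boldsymbol{x})\}$ with $y_j(\boldsymbol{x})=b_{S,j}+\sum_{i=1}^nI_i(\boldsymbol{x})w_{ij}$, $j=1,\dots,m$. Let $i_0\in\{1,\dots,n\}$, $j_0\in\{1,\dots,m\}$, and let $\boldsymbol{x}\in\mathcal{X}$ be a non-vanishing input for $i_0$, i.e. $I_{i_0}:=I_{i_0}(\boldsymbol{x})\neq0$. Let $z_{j_0}$ and $\tilde z_{j_0}$ be the values obtained by the two-step ReLU attack (described in the context) on input $\boldsymbol{x}$ with target parameter the weight $w_{i_0j_0}$. Then \[ w_{i_0j_0}=\frac{1}{2I_{i_0}}\,(z_{j_0}-\tilde z_{j_0}). \]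
   Context: All computations are in exact real arithmetic. The student network consists of a fixed known feature map $\boldsymbol{I}=(I_1,\dots,I_n):\mathcal{X}\to\mathbb{R}^n$ (the first $k-1$ layers of a public teacher network) followed by one fully connected layer with ReLU activation. Faults (SNIFF, sign bit flip fault), applied during an execution on $\boldsymbol{x}$: a SNIFF on the weight $w_{i_0j_0}$ replaces the product $I_{i_0}(\boldsymbol{x})w_{i_0j_0}$ by $-I_{i_0}(\boldsymbol{x})w_{i_0j_0}$ in the computation of $y_{j_0}$; a SNIFF on the summation $y_{j_0}$ replaces the computed sum $y_{j_0}$ by its negative just before the activation is applied. If both are injected in the same execution, first the product is negated, giving a sum $\tilde y_{j_0}$, and then this sum is negated, so the activation is applied to $-\tilde y_{j_0}$. Two-step ReLU attack for target weight $w_{i_0j_0}$ on input $\boldsymbol{x}$: Step 1. If the correct (fault-free) value of $\mathcal{O}_{\theta,j_0}(\boldsymbol{x})$ is nonzero, let $z_{j_0}$ be this value. If it is $0$, execute the network on $\boldsymbol{x}$ again with a SNIFF on the summation $y_{j_0}$, and let $z_{j_0}$ be the negative of the faulted value of $\mathcal{O}_{\theta,j_0}(\boldsymbol{x})$. Step 2. Execute the network on $\boldsymbol{x}$ with a SNIFF on $w_{i_0j_0}$. If the faulted value of $\mathcal{O}_{\theta,j_0}(\boldsymbol{x})$ is nonzero, let $\tilde z_{j_0}$ be this value. Otherwise, execute the network on $\boldsymbol{x}$ with SNIFF on both $w_{i_0j_0}$ and the summation $y_{j_0}$, and let $\tilde z_{j_0}$ be the negative of the faulted value of $\mathcal{O}_{\theta,j_0}(\boldsymbol{x})$.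 *)

theory Defs
  imports "HOL-Analysis.Analysis"
begin

text \<open>
  The feature map is \<open>I :: 'x \<Rightarrow> real ^ 'n\<close>, the weight matrix of the last layer is
  \<open>W :: real ^ 'm ^ 'n\<close> with \<open>W $ i $ j\<close> the weight from feature \<open>i\<close> to neuron \<open>j\<close>, and the
  bias is \<open>b :: real ^ 'm\<close>.
\<close>

definition relu :: "real \<Rightarrow> real" where
  "relu t = max 0 t"

definition student_sum ::
  "('x \<Rightarrow> real ^ 'n) \<Rightarrow> real ^ 'm ^ 'n \<Rightarrow> real ^ 'm \<Rightarrow> 'x \<Rightarrow> 'm \<Rightarrow> real" where
  "student_sum I W b x j = b $ j + (\<Sum>i\<in>UNIV. I x $ i * W $ i $ j)"

definition student_output ::
  "('x \<Rightarrow> real ^ 'n) \<Rightarrow> real ^ 'm ^ 'n \<Rightarrow> real ^ 'm \<Rightarrow> 'x \<Rightarrow> real ^ 'm" where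
  "student_output I W b x = (\<chi> j. relu (student_sum I W b x j))"

text \<open>
  The possible sign bit flip faults: on the product formed with the weight \<open>W $ i $ j\<close>, and on
  the summation of neuron \<open>j\<close>. An execution is subject to a set of faults; the stored parameters
  themselves are never modified.
\<close>

datatype ('n, 'm) sniff = Sniff_weight 'n 'm | Sniff_sum 'm

definition flip_if :: "bool \<Rightarrow> real \<Rightarrow> real" where
  "flip_if P t = (if P then - t else t)"

definition faulted_sum ::
  "('x \<Rightarrow> real ^ 'n) \<Rightarrow> real ^ 'm ^ 'n \<Rightarrow> real ^ 'm \<Rightarrow> ('n, 'm) sniff set \<Rightarrow> 'x \<Rightarrow> 'm \<Rightarrow> real" where
  "faulted_sum I W b F x j =
     b $ j + (\<Sum>i\<in>UNIV. flip_if (Sniff_weight i j \<in> F) (I x $ i * W $ i $ j))"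

definition execute ::
  "('x \<Rightarrow> real ^ 'n) \<Rightarrow> real ^ 'm ^ 'n \<Rightarrow> real ^ 'm \<Rightarrow> ('n, 'm) sniff set \<Rightarrow> 'x \<Rightarrow> real ^ 'm" where
  "execute I W b F x = (\<chi> j. relu (flip_if (Sniff_sum j \<in> F) (faulted_sum I W b F x j)))"

lemma execute_no_faults: "execute I W b {} x = student_output I W b x"
  by (simp add: execute_def student_output_def faulted_sum_def student_sum_def flip_if_def)

text \<open>
  The attack sees the network only through its executions: \<open>E F x\<close> is the output vector observed
  on input \<open>x\<close> when the faults in \<open>F\<close> are injected.
\<close>

definition relu_attack_step1 ::
  "(('n, 'm) sniff set \<Rightarrow> 'x \<Rightarrow> real ^ 'm) \<Rightarrow> 'm \<Rightarrow> 'x \<Rightarrow> real" where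
  "relu_attack_step1 E j0 x =
     (if E {} x $ j0 \<noteq> 0 then E {} x $ j0 else - (E {Sniff_sum j0} x $ j0))"

definition relu_attack_step2 ::
  "(('n, 'm) sniff set \<Rightarrow> 'x \<Rightarrow> real ^ 'm) \<Rightarrow> 'n \<Rightarrow> 'm \<Rightarrow> 'x \<Rightarrow> real" where
  "relu_attack_step2 E i0 j0 x =
     (if E {Sniff_weight i0 j0} x $ j0 \<noteq> 0 then E {Sniff_weight i0 j0} x $ j0
      else - (E {Sniff_weight i0 j0, Sniff_sum j0} x $ j0))"

end

theory Submission
  imports Defs
begin

text \<open>
  Since \<open>relu y = 0\<close> forces \<open>relu (- y) = - y\<close>, negating the summation recovers the sign that the
  activation hides: each step of the attack returns the exact pre-activation sum. The two
  sums differ only in the product at \<open>i0\<close>, which contributes with opposite signs.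
\<close>

lemma relu_reveal: "(if relu t \<noteq> 0 then relu t else - relu (- t)) = t"
  by (simp add: relu_def max_def)

lemma execute_component:
  "execute I W b F x $ j = relu (flip_if (Sniff_sum j \<in> F) (faulted_sum I W b F x j))"
  by (simp add: execute_def)

lemma faulted_sum_insert_Sniff_sum:
  "faulted_sum I W b (insert (Sniff_sum k) F) x j = faulted_sum I W b F x j"
  by (simp add: faulted_sum_def)

lemma faulted_sum_empty: "faulted_sum I W b {} x j = student_sum I W b x j"
  by (simp add: faulted_sum_def student_sum_def flip_if_def)

lemma relu_attack_step1_execute:
  "relu_attack_step1 (execute I W b) j x = student_sum I W b x j"
  by (simp add: relu_attack_step1_def execute_component faulted_sum_insert_Sniff_sum
      faulted_sum_empty flip_if_def relu_reveal
      cong: if_cong split del: if_split)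

lemma relu_attack_step2_execute:
  "relu_attack_step2 (execute I W b) i j x = faulted_sum I W b {Sniff_weight i j} x j"
  by (simp add: relu_attack_step2_def execute_component faulted_sum_insert_Sniff_sum
      insert_commute[of "Sniff_weight i j"] flip_if_def relu_reveal
      cong: if_cong split del: if_split)

lemma student_sum_minus_faulted_sum:
  "student_sum I W b x j - faulted_sum I W b {Sniff_weight i j} x j = 2 * (I x $ i * W $ i $ j)"
proof -
  have "student_sum I W b x j - faulted_sum I W b {Sniff_weight i j} x j =
      (\<Sum>k\<in>UNIV. if k = i then 2 * (I x $ i * W $ i $ j) else 0)"
    unfolding student_sum_def faulted_sum_def flip_if_def
    by (simp add: sum_subtractf[symmetric] del: sum.delta sum.delta') (rule sum.cong, auto)
  then show ?thesis
    by simp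
qed

theorem theorem8:
  fixes X :: "'x set"
    and I :: "'x \<Rightarrow> real ^ 'n"
    and W :: "real ^ 'm ^ 'n"
    and b :: "real ^ 'm"
    and i0 :: 'n and j0 :: 'm
    and x :: 'x
    and z z' :: real
  assumes "x \<in> X"
    and "I x $ i0 \<noteq> 0"
    and "z = relu_attack_step1 (execute I W b) j0 x"
    and "z' = relu_attack_step2 (execute I W b) i0 j0 x"
  shows "W $ i0 $ j0 = 1 / (2 * I x $ i0) * (z - z')"
  using assms(2) student_sum_minus_faulted_sum[of I W b x j0 i0]
  unfolding assms(3,4) relu_attack_step1_execute relu_attack_step2_execute
  by simp

end
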